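(* Let $\sigma: G\rightarrow\operatorname{Aut}(K,K^+,u)$ be an action of a discrete group $G$ on an ordered abelian group $(K,K^+,u)$. Then $\sigma$ is MF if and only if it satisfies the coboundary condition.
   Context: An ordered abelian group $(K,K^+,u)$ consists of an abelian group $K$, a subsemigroup $K^+\subseteq K$ generating $K$ with $K^+\cap(-K^+)=\{0\}$, and a distinguished order unit $u\in K^+$ (for all $x\in K$ there is $n\in\mathbb{N}$ with $-nu\le x\le nu$, where $x\le y$ means $y-x\in K^+$). $\operatorname{Aut}(K,K^+,u)$ is the group of group automorphisms of $K$ that preserve $K^+$ (in both directions) and fix $u$. An action is a group homomorphism $s\mapsto\sigma_s$. The coboundary subgroup of $\sigma$ is $H_\sigma=\langle x-\sigma_s(x): x\in K,\ s\in G\rangle\le K$. The action $\sigma$ satisfies the coboundary condition if $H_\sigma\cap K^+=\{0\}$. The action $\sigma$ is MF if for all finite subsets $S\subset K^+\setminus\{0\}$ and $\Gamma\subset G$ there are a subgroup $H\le K$ containing $S$ and a group homomorphism $\mu:H\to\mathbb{Z}$ such that (1) $\{\sigma_t(g):t\in\Gamma,\ g\in S\}\subset H$; (2) $\mu(g)>0$ for each $g\in S$; and (3) $\mu(\sigma_t(g))=\mu(g)$ for all $g\in S$ and $t\in\Gamma$. *)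

theory Defs
  imports "HOL-Algebra.Algebra"
begin

text \<open>
  Groups are those of HOL-Algebra, so the abelian group \<open>K\<close> is written multiplicatively:
  \<open>x \<otimes> inv y\<close> is the difference of \<open>x\<close> and \<open>y\<close>, \<open>u [^] n\<close> is the \<open>n\<close>-fold sum of \<open>u\<close>,
  and \<open>\<one>\<close> is the zero of \<open>K\<close>.  The positive cone is the set \<open>P\<close>.
\<close>

definition cone_le :: "('k, 'n) monoid_scheme \<Rightarrow> 'k set \<Rightarrow> 'k \<Rightarrow> 'k \<Rightarrow> bool"
  where "cone_le K P x y \<longleftrightarrow> y \<otimes>\<^bsub>K\<^esub> inv\<^bsub>K\<^esub> x \<in> P"

locale ordered_abelian_group = comm_group K for K (structure) +
  fixes P :: "'a set" and u :: 'a
  assumes cone_subset: "P \<subseteq> carrier K"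
    and cone_closed: "\<lbrakk>x \<in> P; y \<in> P\<rbrakk> \<Longrightarrow> x \<otimes> y \<in> P"
    and cone_generates: "generate K P = carrier K"
    and cone_proper: "P \<inter> (\<lambda>x. inv x) ` P = {\<one>}"
    and unit_in_cone: "u \<in> P"
    and order_unit: "x \<in> carrier K \<Longrightarrow>
      \<exists>n::nat. cone_le K P (inv (u [^] n)) x \<and> cone_le K P x (u [^] n)"

text \<open>
  \<open>AutoGroup K\<close> has composition as its product; its elements are extensional functions, that
  is, \<open>undefined\<close> outside \<open>carrier K\<close>.
\<close>

definition order_auto :: "('k, 'n) monoid_scheme \<Rightarrow> 'k set \<Rightarrow> 'k \<Rightarrow> ('k \<Rightarrow> 'k) set"
  where "order_auto K P u = {f \<in> auto K. f ` P = P \<and> f u = u}"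

definition OrderAutoGroup :: "('k, 'n) monoid_scheme \<Rightarrow> 'k set \<Rightarrow> 'k \<Rightarrow> ('k \<Rightarrow> 'k) monoid"
  where "OrderAutoGroup K P u = (AutoGroup K)\<lparr>carrier := order_auto K P u\<rparr>"

lemma (in ordered_abelian_group) subgroup_order_auto:
  "subgroup (order_auto K P u) (AutoGroup K)"
proof -
  interpret A: group "AutoGroup K" by (rule AutoGroup)
  have carrier_A: "carrier (AutoGroup K) = auto K" by (simp add: AutoGroup_def)
  have uK: "u \<in> carrier K" using unit_in_cone cone_subset by blast
  have Bij_auto: "f \<in> Bij (carrier K)" if "f \<in> auto K" for f
    using that by (simp add: auto_def)
  have mult: "f \<otimes>\<^bsub>AutoGroup K\<^esub> g = compose (carrier K) f g"
    if "f \<in> auto K" "g \<in> auto K" for f g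
    using that by (simp add: AutoGroup_def BijGroup_def Bij_auto)
  have one: "\<one>\<^bsub>AutoGroup K\<^esub> = (\<lambda>x\<in>carrier K. x)"
    by (simp add: AutoGroup_def BijGroup_def)
  have comp: "compose (carrier K) f g ` P = f ` g ` P" for f g :: "'a \<Rightarrow> 'a"
    using cone_subset by (force simp: compose_def image_iff)
  have id: "(\<lambda>x\<in>carrier K. x) ` P = P"
    using cone_subset by (force simp: image_iff)
  show ?thesis
  proof (rule A.subgroupI)
    show "order_auto K P u \<subseteq> carrier (AutoGroup K)"
      by (auto simp: order_auto_def carrier_A)
    have "(\<lambda>x\<in>carrier K. x) \<in> auto K" using A.one_closed by (simp only: one carrier_A)
    then have "(\<lambda>x\<in>carrier K. x) \<in> order_auto K P u"
      unfolding order_auto_def using id uK by (intro CollectI conjI) (assumption+, simp)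
    then show "order_auto K P u \<noteq> {}" by blast
  next
    fix f assume f: "f \<in> order_auto K P u"
    then have fA: "f \<in> auto K" by (simp add: order_auto_def)
    define g where "g = inv\<^bsub>AutoGroup K\<^esub> f"
    have gA: "g \<in> auto K" using A.inv_closed fA by (simp add: g_def carrier_A)
    have "g \<otimes>\<^bsub>AutoGroup K\<^esub> f = \<one>\<^bsub>AutoGroup K\<^esub>"
      using A.l_inv fA by (simp add: g_def carrier_A)
    then have gf: "compose (carrier K) g f = (\<lambda>x\<in>carrier K. x)"
      by (simp only: one mult[OF gA fA])
    have "g ` P = g ` f ` P" using f by (simp add: order_auto_def)
    also have "\<dots> = P" by (simp only: comp[symmetric] gf id)
    finally have "g ` P = P" .
    moreover have "g u = u"
      using fun_cong[OF gf, of u] f uK by (simp add: compose_def order_auto_def)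
    ultimately show "inv\<^bsub>AutoGroup K\<^esub> f \<in> order_auto K P u"
      using gA by (simp add: order_auto_def flip: g_def)
  next
    fix f g assume f: "f \<in> order_auto K P u" and g: "g \<in> order_auto K P u"
    then have fg: "f \<in> auto K" "g \<in> auto K" by (auto simp: order_auto_def)
    have "compose (carrier K) f g \<in> auto K"
      using A.m_closed fg by (simp add: carrier_A flip: mult)
    then show "f \<otimes>\<^bsub>AutoGroup K\<^esub> g \<in> order_auto K P u"
      using f g uK by (simp add: mult[OF fg] order_auto_def comp) (simp add: compose_def)
  qed
qed

lemma (in ordered_abelian_group) group_OrderAutoGroup: "group (OrderAutoGroup K P u)"
  unfolding OrderAutoGroup_def
  by (rule subgroup.subgroup_is_group[OF subgroup_order_auto AutoGroup])

definition coboundary_subgroup ::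
    "('g, 'm) monoid_scheme \<Rightarrow> ('k, 'n) monoid_scheme \<Rightarrow> ('g \<Rightarrow> 'k \<Rightarrow> 'k) \<Rightarrow> 'k set"
  where "coboundary_subgroup G K \<sigma> =
    generate K {x \<otimes>\<^bsub>K\<^esub> inv\<^bsub>K\<^esub> (\<sigma> s x) | x s. x \<in> carrier K \<and> s \<in> carrier G}"

definition coboundary_condition ::
    "('g, 'm) monoid_scheme \<Rightarrow> ('k, 'n) monoid_scheme \<Rightarrow> 'k set \<Rightarrow> ('g \<Rightarrow> 'k \<Rightarrow> 'k) \<Rightarrow> bool"
  where "coboundary_condition G K P \<sigma> \<longleftrightarrow> coboundary_subgroup G K \<sigma> \<inter> P = {\<one>\<^bsub>K\<^esub>}"

definition MF_action ::
    "('g, 'm) monoid_scheme \<Rightarrow> ('k, 'n) monoid_scheme \<Rightarrow> 'k set \<Rightarrow> ('g \<Rightarrow> 'k \<Rightarrow> 'k) \<Rightarrow> bool"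
  where "MF_action G K P \<sigma> \<longleftrightarrow>
    (\<forall>S \<Gamma>. finite S \<and> S \<subseteq> P - {\<one>\<^bsub>K\<^esub>} \<and> finite \<Gamma> \<and> \<Gamma> \<subseteq> carrier G \<longrightarrow>
      (\<exists>H \<mu>. subgroup H K \<and> S \<subseteq> H \<and> \<mu> \<in> hom (K\<lparr>carrier := H\<rparr>) integer_group \<and>
        {\<sigma> t g | t g. t \<in> \<Gamma> \<and> g \<in> S} \<subseteq> H \<and>
        (\<forall>g\<in>S. \<mu> g > 0) \<and>
        (\<forall>g\<in>S. \<forall>t\<in>\<Gamma>. \<mu> (\<sigma> t g) = \<mu> g)))"

end

theory Submission
  imports Defs
begin

text \<open>
  Let \<open>C\<close> be the coboundary subgroup, and write \<open>K\<close> additively.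

  An MF witness \<open>\<mu>\<close> for \<open>S\<close> and \<open>\<Gamma>\<close> vanishes on \<open>g - \<sigma> t g\<close> for \<open>g \<in> S\<close> and \<open>t \<in> \<Gamma>\<close>.
  The positive cone generates \<open>K\<close>, so an element \<open>p\<close> of \<open>C\<close> is an integer combination of finitely
  many such differences with \<open>g\<close> positive.  If \<open>p\<close> were positive and nonzero, \<open>S\<close> could
  be chosen to contain \<open>p\<close> as well, and \<open>\<mu> p\<close> would be both zero and positive.

  Conversely, let \<open>C\<close> meet the cone only in zero and let \<open>S\<close> be a finite set of nonzero positive
  elements.  A nonnegative integer combination of \<open>S\<close> that lies in \<open>C\<close> is zero, and because the
  cone is proper all its coefficients are zero.  Hence the lattice of relations that \<open>S\<close>
  satisfies modulo \<open>C\<close> contains no nonzero nonnegative vector.  By an integral form of Stiemke's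
  theorem (\<open>stiemke_int\<close>) some strictly positive integer vector is orthogonal to this
  lattice.  Its entries are the values on \<open>S\<close> of a homomorphism on the subgroup generated by \<open>S\<close>
  and \<open>C\<close> that vanishes on \<open>C\<close> (\<open>exists_hom_of_annihilator\<close>).  This homomorphism is
  invariant under all of \<open>G\<close>, so it serves every \<open>\<Gamma>\<close> at once.
\<close>

section \<open>Stiemke's theorem over the integers\<close>

text \<open>
  Induction on the number of coordinates.  Suppose there are at least two.  If, for two
  different coordinates \<open>t\<close>, deleting \<open>t\<close> preserves the hypothesis, each deletion yields an
  orthogonal vector that is zero at \<open>t\<close> and positive elsewhere, and the sum of the two is
  positive everywhere.  Otherwise some \<open>n \<in> R\<close> is negative at a coordinate \<open>t\<close>, nonnegative and
  not zero at the others.  The vectors of \<open>R\<close> with \<open>t\<close>-entry zero satisfy the hypothesis on the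
  remaining coordinates, and the vector \<open>a\<close> that the induction yields for them
  extends to \<open>t\<close>: after scaling by \<open>- n t\<close>, orthogonality to \<open>n\<close> dictates the entry at \<open>t\<close>, and
  the signs of \<open>n\<close> make it positive.
\<close>

lemma stiemke_int:
  fixes R :: "('a \<Rightarrow> int) set"
  assumes "finite T"
    and "\<And>r s c d. r \<in> R \<Longrightarrow> s \<in> R \<Longrightarrow> (\<lambda>t. c * r t + d * s t) \<in> R"
    and "\<And>r. r \<in> R \<Longrightarrow> \<forall>t\<in>T. r t \<ge> 0 \<Longrightarrow> \<forall>t\<in>T. r t = 0"
  shows "\<exists>a. (\<forall>t\<in>T. a t > 0) \<and> (\<forall>r\<in>R. (\<Sum>t\<in>T. a t * r t) = 0)"
  using assms
proof (induction "card T" arbitrary: T R rule: less_induct)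
  case less
  note fin = less.prems(1) and comb = less.prems(2) and pointed = less.prems(3)
  define good where
    "good t \<longleftrightarrow> (\<forall>r\<in>R. (\<forall>s\<in>T-{t}. r s \<ge> 0) \<longrightarrow> (\<forall>s\<in>T-{t}. r s = 0))" for t
  have vanishing_at: "\<exists>a. a t = 0 \<and> (\<forall>s\<in>T-{t}. a s > 0) \<and> (\<forall>r\<in>R. (\<Sum>s\<in>T. a s * r s) = 0)"
    if t: "t \<in> T" and "good t" for t
  proof -
    have "card (T - {t}) < card T" by (rule card_Diff1_less[OF fin t])
    then have "\<exists>a. (\<forall>s\<in>T-{t}. a s > 0) \<and> (\<forall>r\<in>R. (\<Sum>s\<in>T-{t}. a s * r s) = 0)"
      by (rule less.hyps) (use fin comb \<open>good t\<close> in \<open>simp_all add: good_def\<close>)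
    then obtain a where a: "\<forall>s\<in>T-{t}. a s > 0" "\<forall>r\<in>R. (\<Sum>s\<in>T-{t}. a s * r s) = 0"
      by blast
    have "(\<Sum>s\<in>T. (a(t := 0)) s * r s) = (\<Sum>s\<in>T-{t}. a s * r s)" for r
      by (simp add: sum.remove[OF fin t])
    with a show ?thesis by (intro exI[of _ "a(t := 0)"]) simp
  qed
  consider (bad) t where "t \<in> T" "\<not> good t"
    | (two) t t' where "t \<in> T" "t' \<in> T" "t \<noteq> t'" "good t" "good t'"
    | (single) t where "T = {t}"
    | (empty) "T = {}"
    by blast
  then show ?case
  proof cases
    case bad
    then obtain n where n: "n \<in> R" "\<forall>s\<in>T-{t}. n s \<ge> 0" "\<not> (\<forall>s\<in>T-{t}. n s = 0)"
      unfolding good_def by blast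
    have nt: "n t < 0"
    proof (rule ccontr)
      assume "\<not> n t < 0"
      then have "\<forall>s\<in>T. n s \<ge> 0" using n(2) by auto
      then show False using pointed[OF n(1)] n(3) by blast
    qed
    define R' where "R' = {r \<in> R. r t = 0}"
    have comb': "(\<lambda>x. c * r x + d * s x) \<in> R'" if "r \<in> R'" "s \<in> R'" for r s c d
      using that comb by (simp add: R'_def)
    have pointed': "\<forall>s\<in>T-{t}. r s = 0" if "r \<in> R'" "\<forall>s\<in>T-{t}. r s \<ge> 0" for r
    proof -
      have "r \<in> R" "\<forall>s\<in>T. r s \<ge> 0" using that by (auto simp: R'_def)
      from pointed[OF this] show ?thesis by blast
    qed
    have "card (T - {t}) < card T" by (rule card_Diff1_less[OF fin \<open>t \<in> T\<close>])
    then have "\<exists>a. (\<forall>s\<in>T-{t}. a s > 0) \<and> (\<forall>r\<in>R'. (\<Sum>s\<in>T-{t}. a s * r s) = 0)"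
      using fin by (intro less.hyps comb' pointed') simp_all
    then obtain a where
      a: "\<forall>s\<in>T-{t}. a s > 0" "\<forall>r\<in>R'. (\<Sum>s\<in>T-{t}. a s * r s) = 0"
      by blast
    define b where "b s = (if s = t then \<Sum>s\<in>T-{t}. a s * n s else - n t * a s)" for s
    have "(\<Sum>s\<in>T-{t}. a s * n s) > 0"
    proof -
      obtain s where s: "s \<in> T-{t}" "n s \<noteq> 0" using n(3) by blast
      then have "n s > 0" using n(2) by (metis order_less_le)
      then have "a s * n s > 0" using s(1) a(1) by simp
      moreover have "a x * n x \<ge> 0" if "x \<in> T-{t}" for x
        using that n(2) a(1) by (simp add: less_imp_le)
      ultimately show ?thesis using fin s(1) by (intro sum_pos2[of _ s]) auto
    qed
    then have "\<forall>s\<in>T. b s > 0" using a(1) nt by (simp add: b_def mult_neg_pos)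
    moreover have "(\<Sum>s\<in>T. b s * r s) = 0" if r: "r \<in> R" for r
    proof -
      \<comment> \<open>Eliminating the coordinate \<open>t\<close> between \<open>r\<close> and \<open>n\<close> gives an element of \<open>R'\<close>.\<close>
      have "(\<lambda>s. - n t * r s + r t * n s) \<in> R'" 
        using comb[OF r n(1), of "- n t" "r t"] by (simp add: R'_def)
      then have "0 = (\<Sum>s\<in>T-{t}. a s * (- n t * r s + r t * n s))"
        by (rule bspec[OF a(2), symmetric])
      also have "\<dots> = (\<Sum>s\<in>T-{t}. b s * r s + r t * (a s * n s))"
        by (rule sum.cong) (auto simp: b_def algebra_simps)
      also have "\<dots> = (\<Sum>s\<in>T. b s * r s)"
        by (simp only: sum.distrib sum.remove[OF fin \<open>t \<in> T\<close>] flip: sum_distrib_left)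
          (simp add: b_def mult.commute)
      finally show ?thesis by simp
    qed
    ultimately show ?thesis by blast
  next
    case two
    obtain a where a: "a t = 0" "\<forall>s\<in>T-{t}. a s > 0" "\<forall>r\<in>R. (\<Sum>s\<in>T. a s * r s) = 0"
      using vanishing_at two by metis
    obtain b where b: "b t' = 0" "\<forall>s\<in>T-{t'}. b s > 0" "\<forall>r\<in>R. (\<Sum>s\<in>T. b s * r s) = 0"
      using vanishing_at two by metis
    have "a s + b s > 0" if "s \<in> T" for s
    proof -
      have "s \<noteq> t \<Longrightarrow> a s > 0" "s \<noteq> t' \<Longrightarrow> b s > 0" using a(2) b(2) that by simp_all
      with a(1) b(1) \<open>t \<noteq> t'\<close> show ?thesis by (cases "s = t"; cases "s = t'") simp_all
    qed
    with a(3) b(3) show ?thesis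
      by (intro exI[of _ "\<lambda>s. a s + b s"]) (simp add: distrib_right sum.distrib)
  next
    case single
    have "r t = 0" if r: "r \<in> R" for r
      using pointed[OF r] pointed[OF comb[OF r r, of "-1" 0]] single
      by (cases "r t \<ge> 0") simp_all
    with single show ?thesis by (intro exI[of _ "\<lambda>_. 1"]) simp
  qed simp
qed

section \<open>Homomorphisms prescribed on finitely many elements\<close>

definition (in comm_group) int_combination :: "'a set \<Rightarrow> ('a \<Rightarrow> int) \<Rightarrow> 'a"
  where "int_combination S r = (\<Otimes>g\<in>S. g [^] r g)"

context comm_group
begin

lemma int_combination_closed [simp]:
  "S \<subseteq> carrier G \<Longrightarrow> int_combination S r \<in> carrier G"
  unfolding int_combination_def by (rule finprod_closed) blast

lemma int_combination_insert:
  assumes "finite S" "g \<notin> S" "insert g S \<subseteq> carrier G"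
  shows "int_combination (insert g S) r = g [^] r g \<otimes> int_combination S r"
  using assms unfolding int_combination_def by (intro finprod_insert) auto

lemma int_combination_linear:
  assumes "finite S" "S \<subseteq> carrier G"
  shows "int_combination S (\<lambda>g. c * r g + d * s g)
    = int_combination S r [^] (c::int) \<otimes> int_combination S s [^] (d::int)"
  using assms
proof (induction S)
  case empty
  then show ?case by (simp add: int_combination_def)
next
  case (insert g S)
  then show ?case
    by (simp add: int_combination_insert int_pow_distrib int_pow_mult int_pow_pow
        mult.commute m_ac)
qed

lemma int_combination_single:
  assumes "finite S" "S \<subseteq> carrier G" "g \<in> S"
  shows "int_combination S (\<lambda>x. if x = g then 1 else 0) = g"
proof -
  have "int_combination (S - {g}) (\<lambda>x. if x = g then 1 else 0) = \<one>"
    unfolding int_combination_def by (rule finprod_one_eqI) simp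
  with assms int_combination_insert[of "S - {g}" g "\<lambda>x. if x = g then 1 else 0"]
  show ?thesis by (auto simp: insert_absorb subset_iff)
qed

text \<open>
  The values \<open>a\<close> on \<open>S\<close> and zero on \<open>C\<close> determine \<open>\<mu>\<close> on the subgroup generated by \<open>S\<close> and \<open>C\<close>.
  Two expressions of one element differ by a relation modulo \<open>C\<close>, so the orthogonality of \<open>a\<close> to
  these relations is exactly what makes \<open>\<mu>\<close> well defined.
\<close>

lemma exists_hom_of_annihilator:
  fixes a :: "'a \<Rightarrow> int"
  assumes S: "finite S" "S \<subseteq> carrier G"
    and C: "subgroup C G"
    and annihilates: "\<And>r. int_combination S r \<in> C \<Longrightarrow> (\<Sum>g\<in>S. a g * r g) = 0"
  obtains H \<mu> where "subgroup H G" "S \<subseteq> H" "C \<subseteq> H"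
    "\<mu> \<in> hom (G\<lparr>carrier := H\<rparr>) integer_group"
    "\<And>g. g \<in> S \<Longrightarrow> \<mu> g = a g" "\<And>c. c \<in> C \<Longrightarrow> \<mu> c = 0"
proof -
  interpret C: subgroup C G by (rule C)
  have CG: "c \<in> carrier G" if "c \<in> C" for c using that by simp
  define expr where
    "expr h r \<longleftrightarrow> (\<exists>c\<in>C. h = int_combination S r \<otimes> c)" for h r
  define H where "H = {h. \<exists>r. expr h r}"
  define \<mu> where "\<mu> h = (\<Sum>g\<in>S. a g * (SOME r. expr h r) g)" for h
  have \<mu>: "\<mu> h = (\<Sum>g\<in>S. a g * r g)" if hr: "expr h r" for h r
  proof -
    define r' where "r' = (SOME r. expr h r)"
    have "expr h r'" unfolding r'_def by (rule someI[of "expr h", OF hr])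
    then obtain c c' where c: "c \<in> C" "c' \<in> C"
      and eq: "int_combination S r \<otimes> c = int_combination S r' \<otimes> c'"
      using hr unfolding expr_def by metis
    have "int_combination S (\<lambda>g. 1 * r g + (-1) * r' g)
        = int_combination S r \<otimes> inv (int_combination S r')"
      using S(2) by (subst int_combination_linear[OF S]) (simp add: int_pow_neg)
    also have "\<dots> = c' \<otimes> inv c"
    proof -
      have "int_combination S r = int_combination S r' \<otimes> c' \<otimes> inv c"
        using eq S c by (metis CG int_combination_closed inv_solve_right m_closed)
      then show ?thesis
        using S c by (simp add: m_ac CG)
    qed
    finally have "(\<Sum>g\<in>S. a g * (1 * r g + (-1) * r' g)) = 0"
      using c by (intro annihilates) simp
    then show ?thesis unfolding \<mu>_def r'_def[symmetric]
      by (simp add: right_diff_distrib sum_subtractf)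
  qed
  have expr_mult: "expr (x \<otimes> y) (\<lambda>g. r g + s g)" if xy: "expr x r" "expr y s" for x y r s
  proof -
    obtain c d where "c \<in> C" "d \<in> C"
      "x = int_combination S r \<otimes> c" "y = int_combination S s \<otimes> d"
      using xy unfolding expr_def by blast
    then have "x \<otimes> y = int_combination S (\<lambda>g. 1 * r g + 1 * s g) \<otimes> (c \<otimes> d)"
      using S(2) by (subst int_combination_linear[OF S]) (simp add: m_ac CG)
    with \<open>c \<in> C\<close> \<open>d \<in> C\<close> show ?thesis unfolding expr_def by auto
  qed
  have expr_inv: "expr (inv x) (\<lambda>g. - r g)" if x: "expr x r" for x r
  proof -
    obtain c where "c \<in> C" "x = int_combination S r \<otimes> c"
      using x unfolding expr_def by blast
    then have "inv x = int_combination S (\<lambda>g. (-1) * r g + 0 * r g) \<otimes> inv c"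
      using S(2) by (subst int_combination_linear[OF S]) (simp add: int_pow_neg inv_mult CG)
    with \<open>c \<in> C\<close> show ?thesis unfolding expr_def by auto
  qed
  have expr_C: "expr c (\<lambda>_. 0)" if "c \<in> C" for c
    unfolding expr_def by (rule bexI[OF _ that]) (use that in \<open>simp add: int_combination_def\<close>)
  have expr_S: "expr g (\<lambda>x. if x = g then 1 else 0)" if "g \<in> S" for g
    unfolding expr_def
    by (rule bexI[of _ \<one>]) (use that S in \<open>auto simp: int_combination_single\<close>)
  show thesis
  proof (rule that)
    have "H \<subseteq> carrier G" using S(2) by (auto simp: H_def expr_def)
    moreover have "H \<noteq> {}" using expr_C[OF C.one_closed] by (auto simp: H_def)
    ultimately show "subgroup H G"
      by (rule subgroupI) (auto simp: H_def intro: expr_mult expr_inv)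
    show "S \<subseteq> H" using expr_S by (auto simp: H_def)
    show "C \<subseteq> H" using expr_C by (auto simp: H_def)
    have "\<mu> (x \<otimes> y) = \<mu> x + \<mu> y" if xy: "x \<in> H" "y \<in> H" for x y
    proof -
      obtain r s where "expr x r" "expr y s" using xy by (auto simp: H_def)
      then show ?thesis
        using \<mu>[OF expr_mult] \<mu> by (simp add: distrib_left sum.distrib)
    qed
    then show "\<mu> \<in> hom (G\<lparr>carrier := H\<rparr>) integer_group" by (simp add: hom_def)
    show "\<mu> g = a g" if "g \<in> S" for g
      using \<mu>[OF expr_S[OF that]] that S(1) by (simp add: if_distrib sum.delta cong: if_cong)
    show "\<mu> c = 0" if "c \<in> C" for c using \<mu>[OF expr_C[OF that]] by simp
  qed
qed

end

section \<open>Combinations of positive elements\<close>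

context ordered_abelian_group
begin

lemma one_in_cone: "\<one> \<in> P"
  using cone_proper by blast

lemma cone_carrier: "x \<in> P \<Longrightarrow> x \<in> carrier K"
  using cone_subset by blast

lemma cone_pow_closed: "x \<in> P \<Longrightarrow> x [^] (n::nat) \<in> P"
  by (induction n) (auto simp: one_in_cone cone_closed)

lemma cone_mult_eq_one:
  assumes "x \<in> P" "y \<in> P" "x \<otimes> y = \<one>"
  shows "x = \<one>" "y = \<one>"
proof -
  have "x = inv y" using assms cone_carrier by (simp add: inv_equality)
  with assms have "x \<in> P \<inter> (\<lambda>x. inv x) ` P" by blast
  then show "x = \<one>" using cone_proper by blast
  with assms show "y = \<one>" using cone_carrier by simp
qed

lemma cone_pow_eq_one:
  assumes "x \<in> P" "x [^] (n::nat) = \<one>" "n \<noteq> 0"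
  shows "x = \<one>"
proof -
  obtain m where "n = Suc m" using assms(3) not0_implies_Suc by blast
  with assms(2) show ?thesis
    using cone_mult_eq_one(2)[OF cone_pow_closed[OF assms(1), of m] assms(1)] by simp
qed

lemma int_combination_in_cone:
  assumes "finite S" "S \<subseteq> P" "\<And>g. g \<in> S \<Longrightarrow> r g \<ge> 0"
  shows "int_combination S r \<in> P"
  using assms
proof (induction S)
  case (insert g S)
  have "g [^] r g = g [^] nat (r g)" using insert.prems by simp
  moreover have "g [^] nat (r g) \<in> P" using insert.prems by (intro cone_pow_closed) blast
  ultimately have "g [^] r g \<in> P" by simp
  moreover have "insert g S \<subseteq> carrier K" using insert.prems cone_subset by blast
  ultimately show ?case
    using insert by (simp add: int_combination_insert cone_closed)
qed (simp add: int_combination_def one_in_cone)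

text \<open>
  A sum of positive elements is zero only if each of them is, and a nonzero positive element has
  infinite order.
\<close>

lemma int_combination_eq_one:
  assumes "finite S" "S \<subseteq> P - {\<one>}" "\<And>g. g \<in> S \<Longrightarrow> r g \<ge> 0"
    and "int_combination S r = \<one>" and "g \<in> S"
  shows "r g = 0"
proof (rule ccontr)
  assume "r g \<noteq> 0"
  have g: "g \<in> P" "g \<noteq> \<one>" using assms(2,5) by auto
  have pow: "g [^] r g = g [^] nat (r g)" using assms(3,5) by simp
  have "insert g (S - {g}) = S" using assms(5) by blast
  moreover have "S \<subseteq> carrier K" using assms(2) cone_subset by blast
  ultimately have "g [^] nat (r g) \<otimes> int_combination (S - {g}) r = \<one>"
    using int_combination_insert[of "S - {g}" g r] assms(1,4) pow by simp
  moreover have "int_combination (S - {g}) r \<in> P"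
    using assms(1-3) by (intro int_combination_in_cone) auto
  ultimately have "g [^] nat (r g) = \<one>"
    using cone_mult_eq_one(1) cone_pow_closed g(1) by blast
  then show False
    using cone_pow_eq_one[OF g(1), of "nat (r g)"] g(2) \<open>r g \<noteq> 0\<close> assms(3)[OF assms(5)]
    by simp
qed

end

section \<open>Coboundaries and invariant homomorphisms\<close>

lemma OrderAutoGroup_action_hom:
  assumes "\<sigma> \<in> hom G (OrderAutoGroup K P u)" "s \<in> carrier G"
  shows "\<sigma> s \<in> hom K K"
  using hom_in_carrier[OF assms]
  by (simp add: OrderAutoGroup_def order_auto_def auto_def)

context ordered_abelian_group
begin

lemma coboundary_subgroup_is_subgroup:
  assumes "\<And>s. s \<in> carrier G \<Longrightarrow> \<sigma> s \<in> hom K K"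
  shows "subgroup (coboundary_subgroup G K \<sigma>) K"
  unfolding coboundary_subgroup_def
  by (rule generate_is_subgroup) (auto dest: assms hom_in_carrier)

lemma hom_minus_id:
  assumes "f \<in> hom K K"
  shows "(\<lambda>x. x \<otimes> inv (f x)) \<in> hom K K"
  using assms by (auto simp: hom_def Pi_iff inv_mult m_ac)

text \<open>
  For a single \<open>s\<close>, the elements \<open>x\<close> with \<open>x - \<sigma> s x \<in> N\<close> form a subgroup, the preimage of \<open>N\<close>
  under an endomorphism.  If it contains the cone, it is all of \<open>K\<close>, since the cone generates \<open>K\<close>.
\<close>

lemma coboundary_subgroup_le:
  assumes "\<And>s. s \<in> carrier G \<Longrightarrow> \<sigma> s \<in> hom K K"
    and N: "subgroup N K"
    and cone: "\<And>s g. s \<in> carrier G \<Longrightarrow> g \<in> P \<Longrightarrow> g \<otimes> inv (\<sigma> s g) \<in> N"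
  shows "coboundary_subgroup G K \<sigma> \<subseteq> N"
  unfolding coboundary_subgroup_def
proof (rule generate_subgroup_incl[OF _ N], safe)
  fix x s assume x: "x \<in> carrier K" and s: "s \<in> carrier G"
  define d where "d x = x \<otimes> inv (\<sigma> s x)" for x
  interpret d: group_hom K K d
    using hom_minus_id[OF assms(1)[OF s]] by unfold_locales (simp add: d_def[abs_def])
  interpret N: subgroup N K by (rule N)
  have "subgroup {x \<in> carrier K. d x \<in> N} K"
    by (rule subgroupI) (auto intro: exI[of _ \<one>])
  then have "generate K P \<subseteq> {x \<in> carrier K. d x \<in> N}"
    using cone[OF s] cone_carrier by (intro generate_subgroup_incl) (auto simp: d_def)
  then show "x \<otimes> inv (\<sigma> s x) \<in> N" using x cone_generates by (auto simp: d_def)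
qed

text \<open>
  An MF witness without its positivity: invariance alone makes it vanish on coboundaries, and
  positivity is needed only to contradict this.
\<close>

definition invariant_on ::
    "('g \<Rightarrow> 'a \<Rightarrow> 'a) \<Rightarrow> 'a set \<Rightarrow> 'g set \<Rightarrow> 'a set \<Rightarrow> ('a \<Rightarrow> int) \<Rightarrow> bool"
  where "invariant_on \<sigma> S \<Gamma> H \<mu> \<longleftrightarrow>
    subgroup H K \<and> S \<subseteq> H \<and> \<mu> \<in> hom (K\<lparr>carrier := H\<rparr>) integer_group \<and>
    (\<forall>g\<in>S. \<forall>t\<in>\<Gamma>. \<sigma> t g \<in> H \<and> \<mu> (\<sigma> t g) = \<mu> g)"

lemma invariant_on_group_hom:
  assumes "invariant_on \<sigma> S \<Gamma> H \<mu>"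
  shows "group_hom (K\<lparr>carrier := H\<rparr>) integer_group \<mu>"
  using assms subgroup_imp_group unfolding invariant_on_def
  by (intro group_hom.intro group_hom_axioms.intro) auto

lemma invariant_on_coboundary:
  assumes inv: "invariant_on \<sigma> S \<Gamma> H \<mu>" and "g \<in> S" "s \<in> \<Gamma>"
  shows "g \<otimes> inv (\<sigma> s g) \<in> H \<and> \<mu> (g \<otimes> inv (\<sigma> s g)) = 0"
proof -
  interpret h: group_hom "K\<lparr>carrier := H\<rparr>" integer_group \<mu>
    by (rule invariant_on_group_hom[OF inv])
  have H: "subgroup H K" "g \<in> H" "\<sigma> s g \<in> H" "\<mu> (\<sigma> s g) = \<mu> g"
    using assms by (auto simp: invariant_on_def)
  then have "\<mu> (inv (\<sigma> s g)) = - \<mu> (\<sigma> s g)"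
    using h.hom_inv[of "\<sigma> s g"] by (simp add: m_inv_consistent)
  moreover have "inv (\<sigma> s g) \<in> H" by (rule subgroup.m_inv_closed[OF H(1,3)])
  ultimately show ?thesis
    using H h.hom_mult[of g "inv (\<sigma> s g)"] by (simp add: subgroup.m_closed)
qed

text \<open>
  The elements \<open>p\<close> with the stated property form a subgroup: for a sum, take the unions of the two
  sets \<open>S\<close> and of the two sets \<open>\<Gamma>\<close>.  It contains \<open>g - \<sigma> s g\<close> for every positive \<open>g \<noteq> 0\<close>, by taking
  \<open>S = {g}\<close> and \<open>\<Gamma> = {s}\<close>, hence all coboundaries.
\<close>

lemma invariant_on_vanishes_on_coboundary:
  assumes hom: "\<And>s. s \<in> carrier G \<Longrightarrow> \<sigma> s \<in> hom K K"
    and p: "p \<in> coboundary_subgroup G K \<sigma>"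
  obtains S \<Gamma> where "finite S" "S \<subseteq> P - {\<one>}" "finite \<Gamma>" "\<Gamma> \<subseteq> carrier G"
    "\<And>H \<mu>. invariant_on \<sigma> S \<Gamma> H \<mu> \<Longrightarrow> p \<in> H \<and> \<mu> p = 0"
proof -
  define killed where "killed S \<Gamma> x \<longleftrightarrow>
    x \<in> carrier K \<and> (\<forall>H \<mu>. invariant_on \<sigma> S \<Gamma> H \<mu> \<longrightarrow> x \<in> H \<and> \<mu> x = 0)" for S \<Gamma> x
  define N where "N = {x. \<exists>S \<Gamma>. finite S \<and> S \<subseteq> P - {\<one>} \<and> finite \<Gamma> \<and> \<Gamma> \<subseteq> carrier G \<and>
    killed S \<Gamma> x}"
  have killed_one: "killed S \<Gamma> \<one>" for S \<Gamma>
    unfolding killed_def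
  proof (intro conjI allI impI)
    fix H \<mu> assume inv: "invariant_on \<sigma> S \<Gamma> H \<mu>"
    then show "\<one> \<in> H" by (auto simp: invariant_on_def intro: subgroup.one_closed)
    show "\<mu> \<one> = 0" using group_hom.hom_one[OF invariant_on_group_hom[OF inv]] by simp
  qed simp
  have killed_inv: "killed S \<Gamma> (inv x)" if x: "killed S \<Gamma> x" for S \<Gamma> x
    unfolding killed_def
  proof (intro conjI allI impI)
    show "inv x \<in> carrier K" using x by (simp add: killed_def)
    fix H \<mu> assume inv: "invariant_on \<sigma> S \<Gamma> H \<mu>"
    then have H: "subgroup H K" "x \<in> H" "\<mu> x = 0"
      using x by (auto simp: killed_def invariant_on_def)
    show "inv x \<in> H" by (rule subgroup.m_inv_closed[OF H(1,2)])
    show "\<mu> (inv x) = 0"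
      using group_hom.hom_inv[OF invariant_on_group_hom[OF inv], of x] H
      by (simp add: m_inv_consistent)
  qed
  have killed_mult: "killed (S \<union> S') (\<Gamma> \<union> \<Gamma>') (x \<otimes> y)"
    if x: "killed S \<Gamma> x" and y: "killed S' \<Gamma>' y" for S S' \<Gamma> \<Gamma>' x y
    unfolding killed_def
  proof (intro conjI allI impI)
    show "x \<otimes> y \<in> carrier K" using x y by (simp add: killed_def)
    fix H \<mu> assume inv: "invariant_on \<sigma> (S \<union> S') (\<Gamma> \<union> \<Gamma>') H \<mu>"
    then have "invariant_on \<sigma> S \<Gamma> H \<mu>" "invariant_on \<sigma> S' \<Gamma>' H \<mu>"
      by (auto simp: invariant_on_def)
    then have H: "subgroup H K" "x \<in> H" "\<mu> x = 0" "y \<in> H" "\<mu> y = 0"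
      using x y by (auto simp: killed_def invariant_on_def)
    show "x \<otimes> y \<in> H" by (rule subgroup.m_closed[OF H(1,2,4)])
    show "\<mu> (x \<otimes> y) = 0"
      using group_hom.hom_mult[OF invariant_on_group_hom[OF inv], of x y] H by simp
  qed
  have "subgroup N K"
  proof (rule subgroupI)
    show "N \<subseteq> carrier K" by (auto simp: N_def killed_def)
    show "N \<noteq> {}" using killed_one[of "{}" "{}"] unfolding N_def by blast
    show "inv x \<in> N" if "x \<in> N" for x
      using that killed_inv unfolding N_def by blast
    show "x \<otimes> y \<in> N" if xy: "x \<in> N" "y \<in> N" for x y
    proof -
      obtain S \<Gamma> where 1: "finite S" "S \<subseteq> P - {\<one>}" "finite \<Gamma>" "\<Gamma> \<subseteq> carrier G" "killed S \<Gamma> x"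
        using xy(1) unfolding N_def by blast
      obtain S' \<Gamma>' where 2: "finite S'" "S' \<subseteq> P - {\<one>}" "finite \<Gamma>'" "\<Gamma>' \<subseteq> carrier G"
        "killed S' \<Gamma>' y"
        using xy(2) unfolding N_def by blast
      show ?thesis
        unfolding N_def using 1 2 killed_mult[OF 1(5) 2(5)]
        by (intro CollectI exI[of _ "S \<union> S'"] exI[of _ "\<Gamma> \<union> \<Gamma>'"]) auto
    qed
  qed
  moreover have "g \<otimes> inv (\<sigma> s g) \<in> N" if s: "s \<in> carrier G" and g: "g \<in> P" for s g
  proof (cases "g = \<one>")
    case True
    then show ?thesis
      using hom_one[OF hom[OF s] is_group is_group] subgroup.one_closed[OF \<open>subgroup N K\<close>]
      by simp
  next
    case False
    have "killed {g} {s} (g \<otimes> inv (\<sigma> s g))"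
      unfolding killed_def
      using invariant_on_coboundary[of \<sigma> "{g}" "{s}"] cone_carrier[OF g] hom_in_carrier[OF hom[OF s]]
      by auto
    with False g s show ?thesis
      unfolding N_def by (intro CollectI exI[of _ "{g}"] exI[of _ "{s}"]) auto
  qed
  ultimately have "coboundary_subgroup G K \<sigma> \<subseteq> N"
    by (intro coboundary_subgroup_le hom)
  with p have "p \<in> N" by blast
  then obtain S \<Gamma> where S: "finite S" "S \<subseteq> P - {\<one>}" "finite \<Gamma>" "\<Gamma> \<subseteq> carrier G"
      "killed S \<Gamma> p"
    unfolding N_def by blast
  show thesis
  proof (rule that[OF S(1-4)])
    show "p \<in> H \<and> \<mu> p = 0" if "invariant_on \<sigma> S \<Gamma> H \<mu>" for H \<mu>
      using S(5) that by (simp add: killed_def)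
  qed
qed

section \<open>The equivalence\<close>

lemma MF_action_imp_coboundary_condition:
  assumes hom: "\<And>s. s \<in> carrier G \<Longrightarrow> \<sigma> s \<in> hom K K"
    and MF: "MF_action G K P \<sigma>"
  shows "coboundary_condition G K P \<sigma>"
proof -
  have "p = \<one>" if p: "p \<in> coboundary_subgroup G K \<sigma>" "p \<in> P" for p
  proof (rule ccontr)
    assume "p \<noteq> \<one>"
    obtain S \<Gamma> where S: "finite S" "S \<subseteq> P - {\<one>}" "finite \<Gamma>" "\<Gamma> \<subseteq> carrier G"
      and vanish: "\<And>H \<mu>. invariant_on \<sigma> S \<Gamma> H \<mu> \<Longrightarrow> p \<in> H \<and> \<mu> p = 0"
      using invariant_on_vanishes_on_coboundary[where G = G and \<sigma> = \<sigma>, OF hom p(1)]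
      by blast
    have "finite (insert p S)" "insert p S \<subseteq> P - {\<one>}" using S p \<open>p \<noteq> \<one>\<close> by auto
    with S(3,4) have "\<exists>H \<mu>. subgroup H K \<and> insert p S \<subseteq> H \<and>
        \<mu> \<in> hom (K\<lparr>carrier := H\<rparr>) integer_group \<and>
        {\<sigma> t g | t g. t \<in> \<Gamma> \<and> g \<in> insert p S} \<subseteq> H \<and> (\<forall>g\<in>insert p S. \<mu> g > 0) \<and>
        (\<forall>g\<in>insert p S. \<forall>t\<in>\<Gamma>. \<mu> (\<sigma> t g) = \<mu> g)"
      by (intro MF[unfolded MF_action_def, rule_format] conjI)
    then obtain H \<mu> where "subgroup H K" "insert p S \<subseteq> H"
      "\<mu> \<in> hom (K\<lparr>carrier := H\<rparr>) integer_group"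
      "{\<sigma> t g | t g. t \<in> \<Gamma> \<and> g \<in> insert p S} \<subseteq> H"
      and pos: "\<forall>g\<in>insert p S. \<mu> g > 0"
      and "\<forall>g\<in>insert p S. \<forall>t\<in>\<Gamma>. \<mu> (\<sigma> t g) = \<mu> g"
      by (elim exE conjE) (rule that)
    then have "invariant_on \<sigma> S \<Gamma> H \<mu>" unfolding invariant_on_def by blast
    with vanish pos show False by force
  qed
  moreover have "\<one> \<in> coboundary_subgroup G K \<sigma>"
    by (rule subgroup.one_closed[OF coboundary_subgroup_is_subgroup[OF hom]])
  ultimately show ?thesis unfolding coboundary_condition_def using one_in_cone by blast
qed

text \<open>
  The vector \<open>a\<close> is positive and orthogonal to all relations of \<open>S\<close> modulo the coboundary
  subgroup; the homomorphism built from it vanishes on every coboundary, whatever \<open>\<Gamma>\<close> is.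
\<close>

lemma coboundary_condition_imp_MF_action:
  assumes hom: "\<And>s. s \<in> carrier G \<Longrightarrow> \<sigma> s \<in> hom K K"
    and coboundary: "coboundary_condition G K P \<sigma>"
  shows "MF_action G K P \<sigma>"
  unfolding MF_action_def
proof (intro allI impI, elim conjE)
  fix S \<Gamma> assume S: "finite S" "S \<subseteq> P - {\<one>}" and \<Gamma>: "\<Gamma> \<subseteq> carrier G"
  define C where "C = coboundary_subgroup G K \<sigma>"
  have C: "subgroup C K" unfolding C_def by (rule coboundary_subgroup_is_subgroup[OF hom])
  have SK: "S \<subseteq> carrier K" using S cone_subset by blast
  define R where "R = {r. int_combination S r \<in> C}"
  have "(\<lambda>t. c * r t + d * s t) \<in> R" if "r \<in> R" "s \<in> R" for r s c d
    using that C unfolding R_def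
    by (simp add: int_combination_linear[OF S(1) SK] subgroup.m_closed subgroup_int_pow_closed)
  moreover have "\<forall>g\<in>S. r g = 0" if r: "r \<in> R" "\<forall>g\<in>S. r g \<ge> 0" for r
  proof -
    have "int_combination S r \<in> P" using int_combination_in_cone[of S r] S r by blast
    then have "int_combination S r = \<one>"
      using r coboundary unfolding R_def C_def coboundary_condition_def by blast
    then show ?thesis using int_combination_eq_one[OF S] r by blast
  qed
  ultimately obtain a where a: "\<forall>g\<in>S. a g > 0" "\<forall>r\<in>R. (\<Sum>g\<in>S. a g * r g) = 0"
    using stiemke_int[OF S(1), of R] by blast
  obtain H \<mu> where H: "subgroup H K" "S \<subseteq> H" "C \<subseteq> H"
    and \<mu>: "\<mu> \<in> hom (K\<lparr>carrier := H\<rparr>) integer_group"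
      "\<And>g. g \<in> S \<Longrightarrow> \<mu> g = a g" "\<And>c. c \<in> C \<Longrightarrow> \<mu> c = 0"
    using exists_hom_of_annihilator[OF S(1) SK C] a(2) unfolding R_def by blast
  have "\<sigma> t g \<in> H \<and> \<mu> (\<sigma> t g) = \<mu> g" if t: "t \<in> \<Gamma>" and g: "g \<in> S" for t g
  proof -
    have K: "g \<in> carrier K" "\<sigma> t g \<in> carrier K"
      using g t SK \<Gamma> hom_in_carrier[OF hom] by blast+
    define c where "c = g \<otimes> inv (\<sigma> t g)"
    have cC: "c \<in> C"
      unfolding c_def C_def coboundary_subgroup_def using K t \<Gamma> by (intro generate.incl) blast
    have g_eq: "g = c \<otimes> \<sigma> t g" using K by (simp add: c_def m_assoc)
    then have "\<sigma> t g = inv c \<otimes> g" using K by (simp add: inv_solve_left c_def)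
    moreover have "inv c \<in> H" "g \<in> H"
      using cC g H(2,3) subgroup.m_inv_closed[OF H(1)] by blast+
    ultimately have tH: "\<sigma> t g \<in> H" using subgroup.m_closed[OF H(1)] by simp
    have "\<mu> g = \<mu> (c \<otimes> \<sigma> t g)" using g_eq by simp
    also have "\<dots> = \<mu> c + \<mu> (\<sigma> t g)"
      using hom_mult[OF \<mu>(1), of c "\<sigma> t g"] cC H tH by auto
    finally show ?thesis using tH \<mu>(3)[OF cC] by simp
  qed
  then show "\<exists>H \<mu>. subgroup H K \<and> S \<subseteq> H \<and> \<mu> \<in> hom (K\<lparr>carrier := H\<rparr>) integer_group \<and>
      {\<sigma> t g | t g. t \<in> \<Gamma> \<and> g \<in> S} \<subseteq> H \<and> (\<forall>g\<in>S. \<mu> g > 0) \<and>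
      (\<forall>g\<in>S. \<forall>t\<in>\<Gamma>. \<mu> (\<sigma> t g) = \<mu> g)"
    using H(1,2) \<mu>(1,2) a(1) by (intro exI[of _ H] exI[of _ \<mu>] conjI) auto
qed

end

theorem theorem4p7:
  fixes G :: "('g, 'm) monoid_scheme"
    and K :: "('k, 'n) monoid_scheme"
    and P :: "'k set"
    and u :: 'k
    and \<sigma> :: "'g \<Rightarrow> 'k \<Rightarrow> 'k"
  assumes "group G"
    and "ordered_abelian_group K P u"
    and "\<sigma> \<in> hom G (OrderAutoGroup K P u)"
  shows "MF_action G K P \<sigma> \<longleftrightarrow> coboundary_condition G K P \<sigma>"
proof -
  interpret ordered_abelian_group K P u by (rule assms(2))
  have hom: "\<sigma> s \<in> hom K K" if "s \<in> carrier G" for s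
    by (rule OrderAutoGroup_action_hom[OF assms(3) that])
  show ?thesis
    by (rule iffI; rule MF_action_imp_coboundary_condition coboundary_condition_imp_MF_action;
        (rule hom)?)
qed

end
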